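(* Let $A(q)$ be any eta quotient of the form \[ A(q)=f_1^{3j_1+1}\prod_{3\nmid i}f_i^{3j_i}\prod_{3\mid i}f_i^{j_i}=:\sum_{n=0}^{\infty}a_nq^n, \] where the products are finite and all $j_i$ are integers, and let \[ B(q)=\frac{f_3}{f_1^3}A(q)=:\sum_{n=0}^{\infty}b_nq^n. \] Then for all $n\ge0$, \[ a_{3n}-b_{3n}\equiv0\pmod 9,\qquad 2a_{3n+1}+b_{3n+1}\equiv 0\pmod 9,\qquad a_{3n+2}+2b_{3n+2}\equiv 0\pmod 9. \]
   Context: For $|q|<1$ and positive integers $j$, $f_j:=\prod_{n=1}^{\infty}(1-q^{jn})$. *)

theory Defs
  imports "HOL-Analysis.Analysis" "HOL-Number_Theory.Cong"
begin

text \<open>The library product starts at index 0, hence the shift by one.\<close>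

definition euler_f :: "nat \<Rightarrow> complex \<Rightarrow> complex" where
  "euler_f j q = (\<Prod>n. 1 - q ^ (j * Suc n))"

text \<open>
  \<open>T\<close> is the finite range of the product over indices not divisible by 3 (other than 1, whose
  factor is written separately), \<open>U\<close> that of the product over indices divisible by 3.
\<close>

definition eta_A :: "(nat \<Rightarrow> int) \<Rightarrow> nat set \<Rightarrow> nat set \<Rightarrow> complex \<Rightarrow> complex" where
  "eta_A j T U q =
     euler_f 1 q powi (3 * j 1 + 1) *
     (\<Prod>i\<in>T. euler_f i q powi (3 * j i)) *
     (\<Prod>i\<in>U. euler_f i q powi (j i))"

definition eta_B :: "(nat \<Rightarrow> int) \<Rightarrow> nat set \<Rightarrow> nat set \<Rightarrow> complex \<Rightarrow> complex" where
  "eta_B j T U q = euler_f 3 q / euler_f 1 q ^ 3 * eta_A j T U q"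

end

(*
  Write A = f_1 K and B = f_1 K', where K and K' = f_3 K / f_1^3 are products of cubes and of factors
  f_i with 3 | i, so that the derivation D = q d/dq kills both of them modulo 3. Expanding every
  factor of f_1^3 / f_3 modulo 9 gives

    (1 - x)^3 / (1 - x^3) = 1 - 3 x / (1 - x)^2,   x = q^n,

  whence f_1^3 / f_3 = 1 - 3 L modulo 9 with L = sum_n sigma(n) q^n. On the other hand
  D f_1 = - L f_1 exactly, so D B = - L B modulo 3. Hence A = (1 - 3 L) B = B + 3 D B modulo 9, that
  is, a_n = (1 + 3 n) b_n modulo 9.
*)

theory Submission
  imports Defs "HOL-Complex_Analysis.Complex_Analysis"
begin

subsection \<open>Formal Euler products\<close>

lemma fps_X_power_dvd_iff:
  "fps_X ^ N dvd (f :: 'a :: comm_ring_1 fps) \<longleftrightarrow> (\<forall>n<N. fps_nth f n = 0)"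
proof
  assume "fps_X ^ N dvd f"
  then show "\<forall>n<N. fps_nth f n = 0"
    by (auto simp: dvd_def fps_X_power_mult_nth)
next
  assume *: "\<forall>n<N. fps_nth f n = 0"
  have "f = fps_X ^ N * fps_shift N f"
    by (rule fps_ext) (use * in \<open>auto simp: fps_X_power_mult_nth\<close>)
  then show "fps_X ^ N dvd f" by (rule dvdI)
qed

lemma numeral_dvd_fps_iff:
  "(numeral c :: int fps) dvd f \<longleftrightarrow> (\<forall>n. numeral c dvd fps_nth f n)"
proof
  assume "numeral c dvd f"
  then show "\<forall>n. numeral c dvd fps_nth f n"
    by (auto simp: dvd_def fps_numeral_fps_const)
next
  assume *: "\<forall>n. numeral c dvd fps_nth f n"
  have "f = numeral c * Abs_fps (\<lambda>n. fps_nth f n div numeral c)"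
    by (rule fps_ext) (use * in \<open>auto simp: fps_numeral_fps_const\<close>)
  then show "numeral c dvd f" by (rule dvdI)
qed

text \<open>Congruence is written as divisibility of a difference, so that this rule and the next
  serve both truncation, modulo \<open>fps_X ^ N\<close>, and reduction modulo 9.\<close>

lemma dvd_diff_mult:
  fixes d :: "'a :: comm_ring_1"
  assumes "d dvd a - a'" "d dvd b - b'"
  shows "d dvd a * b - a' * b'"
proof -
  have "a * b - a' * b' = (a - a') * b + a' * (b - b')"
    by (simp add: algebra_simps)
  with assms show ?thesis by simp
qed

lemma dvd_diff_trans:
  fixes d :: "'a :: comm_ring_1"
  assumes "d dvd a - b" "d dvd b - c"
  shows "d dvd a - c"
  using dvd_add[OF assms] by simp

lemma fps_XD_mult: "fps_XD (f * g) = fps_XD f * g + f * fps_XD (g :: 'a :: comm_ring_1 fps)"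
  by (simp add: fps_XD_def algebra_simps)

lemma fps_XD_one_minus_X_power:
  "fps_XD (1 - fps_X ^ k :: 'a :: comm_ring_1 fps) = - (of_nat k * fps_X ^ k)"
  by (rule fps_ext) (simp add: fps_of_nat[symmetric])

section \<open>Formal Euler products and their finite truncations\<close>

definition euler_part :: "nat \<Rightarrow> nat \<Rightarrow> int fps" where
  "euler_part i N = (\<Prod>k<N. 1 - fps_X ^ (i * Suc k))"

text \<open>For i > 0 the factors after the first n + 1 are 1 modulo \<open>fps_X ^ Suc n\<close>,
  so the coefficient of index n is already final there. Reading it off avoids a limit of formal
  series.\<close>

definition euler_fps :: "nat \<Rightarrow> int fps" where
  "euler_fps i = Abs_fps (\<lambda>n. fps_nth (euler_part i (Suc n)) n)"

lemma euler_part_0 [simp]: "euler_part i 0 = 1"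
  and euler_part_Suc: "euler_part i (Suc N) = euler_part i N * (1 - fps_X ^ (i * Suc N))"
  by (simp_all add: euler_part_def)

lemma euler_part_stable:
  assumes "i > 0" "M \<le> N"
  shows "fps_X ^ M dvd euler_part i N - euler_part i M"
  using \<open>M \<le> N\<close>
proof (induction N rule: dec_induct)
  case (step N)
  have "M \<le> i * Suc N"
    using step.hyps assms(1) by (metis Suc_leI le_SucI le_trans mult_le_mono1 nat_mult_1 One_nat_def)
  then have "fps_X ^ M dvd (fps_X ^ (i * Suc N) :: int fps)"
    by (rule le_imp_power_dvd)
  then have "fps_X ^ M dvd euler_part i (Suc N) - euler_part i N"
    by (simp add: euler_part_Suc algebra_simps del: mult_Suc_right)
  then show ?case using step.IH by (rule dvd_diff_trans)
qed simp

lemma euler_fps_approx: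
  assumes "i > 0"
  shows "fps_X ^ N dvd euler_fps i - euler_part i N"
  unfolding fps_X_power_dvd_iff
proof (intro allI impI)
  fix n assume "n < N"
  then have "fps_X ^ Suc n dvd euler_part i N - euler_part i (Suc n)"
    using assms by (intro euler_part_stable) auto
  then show "fps_nth (euler_fps i - euler_part i N) n = 0"
    unfolding fps_X_power_dvd_iff by (auto simp: euler_fps_def)
qed

lemma euler_fps_nth_0 [simp]: "i > 0 \<Longrightarrow> fps_nth (euler_fps i) 0 = 1"
  by (simp add: euler_fps_def euler_part_def)

section \<open>Lambert series of the divisor sum and the derivative of f_1\<close>

definition sigma_fps :: "int fps" where
  "sigma_fps = Abs_fps (\<lambda>n. \<Sum>d\<in>{1..n}. if d dvd n then int d else 0)"

text \<open>For k > 0 this is x / (1 - x) with x = X^k; the condition \<open>0 < n\<close> removes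
  the constant term of the geometric series.\<close>

definition geo_fps :: "nat \<Rightarrow> int fps" where
  "geo_fps k = Abs_fps (\<lambda>n. if 0 < n \<and> k dvd n then 1 else 0)"

text \<open>For k > 0 this is x / (1 - x)^2, the sum of m x^m, with x = X^k.\<close>

definition arith_fps :: "nat \<Rightarrow> int fps" where
  "arith_fps k = Abs_fps (\<lambda>n. if k dvd n then int (n div k) else 0)"

lemma geo_fps_eq:
  assumes "k > 0"
  shows "(1 - fps_X ^ k) * geo_fps k = fps_X ^ k"
proof (rule fps_ext)
  fix n
  show "fps_nth ((1 - fps_X ^ k) * geo_fps k) n = fps_nth (fps_X ^ k) n"
  proof (cases "k \<le> n")
    case True
    then have "k dvd n \<longleftrightarrow> k dvd n - k" "n - k = 0 \<longleftrightarrow> n = k"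
      by (simp_all add: dvd_minus_self)
    with True assms show ?thesis
      by (simp add: left_diff_distrib fps_X_power_mult_nth geo_fps_def)
  next
    case False
    then have "\<not> (0 < n \<and> k dvd n)"
      by (auto dest: dvd_imp_le)
    with False show ?thesis
      by (simp add: left_diff_distrib fps_X_power_mult_nth geo_fps_def)
  qed
qed

lemma arith_fps_eq_geo_fps:
  assumes "k > 0"
  shows "(1 - fps_X ^ k) * arith_fps k = geo_fps k"
proof (rule fps_ext)
  fix n
  show "fps_nth ((1 - fps_X ^ k) * arith_fps k) n = fps_nth (geo_fps k) n"
  proof (cases "k \<le> n")
    case True
    then have "k dvd n \<longleftrightarrow> k dvd n - k" "int (n div k) = int ((n - k) div k) + 1"
      using assms by (simp_all add: dvd_minus_self le_div_geq)
    with True assms show ?thesis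
      by (simp add: left_diff_distrib fps_X_power_mult_nth arith_fps_def geo_fps_def)
  next
    case False
    then show ?thesis
      by (auto simp: left_diff_distrib fps_X_power_mult_nth arith_fps_def geo_fps_def dest: dvd_imp_le)
  qed
qed

lemma arith_fps_eq:
  assumes "k > 0"
  shows "(1 - fps_X ^ k)\<^sup>2 * arith_fps k = fps_X ^ k"
  using geo_fps_eq[OF assms] arith_fps_eq_geo_fps[OF assms]
  by (simp add: power2_eq_square mult.assoc)

lemma sigma_fps_nth:
  assumes "n < N"
  shows "fps_nth sigma_fps n = (\<Sum>k<N. if 0 < n \<and> Suc k dvd n then int (Suc k) else 0)"
proof -
  have "fps_nth sigma_fps n = (\<Sum>d\<in>Suc ` {..<n}. if d dvd n then int d else 0)"
    by (simp add: sigma_fps_def image_Suc_lessThan)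
  also have "\<dots> = (\<Sum>k<n. if Suc k dvd n then int (Suc k) else 0)"
    by (subst sum.reindex) auto
  also have "\<dots> = (\<Sum>k<N. if 0 < n \<and> Suc k dvd n then int (Suc k) else 0)"
    using assms by (intro sum.mono_neutral_cong_left) (auto dest: dvd_imp_le)
  finally show ?thesis .
qed

text \<open>The involution d -> n / d on the divisors of n turns the sum of d into the sum of n / d.
  Divisors of a positive n do not exceed n < N, so the cut at N loses nothing; for n = 0 every term
  is 0.\<close>

lemma sigma_fps_nth':
  assumes "n < N"
  shows "fps_nth sigma_fps n = (\<Sum>k<N. if Suc k dvd n then int (n div Suc k) else 0)"
proof (cases "n = 0")
  case False
  then have divisor: "0 < d \<and> d \<le> n" if "d dvd n" for d
    using that by (auto dest: dvd_imp_le intro: gr0I)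
  then have "fps_nth sigma_fps n = (\<Sum>d\<in>{d. d dvd n}. int d)"
    unfolding sigma_fps_def fps_nth_Abs_fps
    by (intro sum.mono_neutral_cong_right) (auto simp: Suc_le_eq)
  also have "\<dots> = (\<Sum>d\<in>{d. d dvd n}. int (n div d))"
    by (rule sum.reindex_bij_witness[where i = "\<lambda>d. n div d" and j = "\<lambda>d. n div d"])
       (use False in auto)
  also have "\<dots> = (\<Sum>d\<in>Suc ` {..<N}. if d dvd n then int (n div d) else 0)"
    using assms
    by (intro sum.mono_neutral_cong_left) (auto simp: image_Suc_lessThan Suc_le_eq dest!: divisor)
  also have "\<dots> = (\<Sum>k<N. if Suc k dvd n then int (n div Suc k) else 0)"
    by (subst sum.reindex) auto
  finally show ?thesis .
qed (simp add: sigma_fps_def)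

text \<open>The Lambert series of k X^k / (1 - X^k), the form in which the logarithmic derivative of
  the Euler product yields the divisor sum.\<close>

lemma sigma_fps_approx_geo:
  "fps_X ^ N dvd sigma_fps - (\<Sum>k<N. of_nat (Suc k) * geo_fps (Suc k))"
  unfolding fps_X_power_dvd_iff
  by (auto simp: sigma_fps_nth fps_sum_nth geo_fps_def fps_of_nat[symmetric]
      simp del: of_nat_Suc intro!: sum.cong)

text \<open>The same series as a sum of X^k / (1 - X^k)^2, the form that arises from cubes of the
  factors modulo 9.\<close>

lemma sigma_fps_approx_arith:
  "fps_X ^ N dvd sigma_fps - (\<Sum>k<N. arith_fps (Suc k))"
  unfolding fps_X_power_dvd_iff
  by (auto simp: sigma_fps_nth' fps_sum_nth arith_fps_def)

text \<open>Logarithmic derivative of a finite product: the factor 1 - X^k contributes - k X^k / (1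
  - X^k).\<close>

lemma fps_XD_euler_part:
  "fps_XD (euler_part 1 N) = - (euler_part 1 N * (\<Sum>k<N. of_nat (Suc k) * geo_fps (Suc k)))"
proof (induction N)
  case 0
  show ?case by (rule fps_ext) simp
next
  case (Suc N)
  let ?P = "euler_part 1 N" and ?x = "fps_X ^ Suc N :: int fps"
  let ?S = "\<Sum>k<N. of_nat (Suc k) * geo_fps (Suc k)"
  have ring: "- (P * S) * (1 - x) + P * - (c * ((1 - x) * g)) = - ((P * (1 - x)) * (S + c * g))"
    for P S x c g :: "int fps"
    by algebra
  have "fps_XD (euler_part 1 (Suc N)) = fps_XD ?P * (1 - ?x) + ?P * - (of_nat (Suc N) * ?x)"
    unfolding euler_part_Suc fps_XD_mult by (simp only: fps_XD_one_minus_X_power mult_1)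
  \<comment> \<open>Writing x as (1 - x) times its geometric series makes the new factor 1 - x
    appear in both summands, without any division.\<close>
  also have "\<dots> = - (?P * ?S) * (1 - ?x) + ?P * - (of_nat (Suc N) * ((1 - ?x) * geo_fps (Suc N)))"
    unfolding Suc.IH by (subst geo_fps_eq) simp_all
  also have "\<dots> = - ((?P * (1 - ?x)) * (?S + of_nat (Suc N) * geo_fps (Suc N)))"
    by (rule ring)
  finally show ?case unfolding euler_part_Suc by simp
qed

theorem fps_XD_euler_fps_1: "fps_XD (euler_fps 1) = - (euler_fps 1 * sigma_fps)"
proof (rule fps_ext)
  fix n
  \<comment> \<open>The coefficient of index n depends only on residues modulo
    \<open>fps_X ^ Suc n\<close>, hence n + 1 factors. The derivation acts coefficientwise and
    respects this.\<close>
  let ?P = "euler_part 1 (Suc n)" and ?S = "\<Sum>k<Suc n. of_nat (Suc k) * geo_fps (Suc k)"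
  have 1: "fps_X ^ Suc n dvd euler_fps 1 - ?P"
    by (rule euler_fps_approx) simp
  have "fps_X ^ Suc n dvd euler_fps 1 * sigma_fps - ?P * ?S"
    by (intro dvd_diff_mult 1 sigma_fps_approx_geo)
  then have "fps_nth (euler_fps 1 * sigma_fps) n = fps_nth (?P * ?S) n"
    unfolding fps_X_power_dvd_iff by auto
  moreover have "fps_nth (fps_XD (euler_fps 1)) n = fps_nth (fps_XD ?P) n"
    using 1 unfolding fps_X_power_dvd_iff by simp
  ultimately show "fps_nth (fps_XD (euler_fps 1)) n = fps_nth (- (euler_fps 1 * sigma_fps)) n"
    unfolding fps_XD_euler_part by simp
qed

section \<open>The quotient f_1^3 / f_3 modulo 9\<close>

lemma cube_factor_mod_9:
  assumes "k > 0"
  shows "9 dvd (1 - fps_X ^ k) ^ 3 - (1 - fps_X ^ (3 * k)) * (1 - 3 * arith_fps k)"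
proof -
  define x h where "x = (fps_X ^ k :: int fps)" and "h = arith_fps k"
  \<comment> \<open>The exact quotient of (1 - x)^3 by 1 - x^3 is 1 - 3 x / (1 + x + x^2), and 1 + x
    + x^2 = (1 - x)^2 + 3 x. The first summand on the right vanishes because h = x / (1 - x)^2; the
    second is the error of replacing the denominator.\<close>
  have "(1 - x) ^ 3 - (1 - x ^ 3) * (1 - 3 * h)
      = 3 * (1 - x) * ((1 - x)\<^sup>2 * h - x) + 9 * (h * x * (1 - x))"
    by algebra
  moreover have "(1 - x)\<^sup>2 * h = x"
    unfolding x_def h_def using assms by (rule arith_fps_eq)
  ultimately have "(1 - x) ^ 3 - (1 - x ^ 3) * (1 - 3 * h) = 9 * (h * x * (1 - x))"
    by simp
  then show ?thesis
    unfolding x_def h_def by (simp add: power_mult[symmetric] mult.commute)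
qed

text \<open>The factors 1 - 3 h multiply to 1 minus 3 times the sum of the h, since every cross term
  carries a factor 9.\<close>

lemma euler_part_cube_mod_9:
  "9 dvd euler_part 1 N ^ 3 - euler_part 3 N * (1 - 3 * (\<Sum>k<N. arith_fps (Suc k)))"
proof (induction N)
  case (Suc N)
  let ?S = "\<Sum>k<N. arith_fps (Suc k)" and ?h = "arith_fps (Suc N)"
  let ?x = "1 - fps_X ^ Suc N :: int fps" and ?y = "1 - fps_X ^ (3 * Suc N) :: int fps"
  have "9 dvd euler_part 1 N ^ 3 * ?x ^ 3 - (euler_part 3 N * (1 - 3 * ?S)) * (?y * (1 - 3 * ?h))"
    by (intro dvd_diff_mult Suc.IH cube_factor_mod_9) simp
  moreover have "(Q * (1 - 3 * S)) * (y * (1 - 3 * h)) - (Q * y) * (1 - 3 * (S + h))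
      = 9 * (Q * y * S * h)" for Q S y h :: "int fps"
    by algebra
  then have "9 dvd (Q * (1 - 3 * S)) * (y * (1 - 3 * h)) - (Q * y) * (1 - 3 * (S + h))"
    for Q S y h :: "int fps"
    by (simp only: dvd_triv_left)
  ultimately have "9 dvd euler_part 1 N ^ 3 * ?x ^ 3 - (euler_part 3 N * ?y) * (1 - 3 * (?S + ?h))"
    by (rule dvd_diff_trans)
  then show ?case
    by (simp only: euler_part_Suc power_mult_distrib mult_1 sum.lessThan_Suc)
qed simp

theorem euler_fps_cube_mod_9:
  "9 dvd euler_fps 1 ^ 3 - euler_fps 3 * (1 - 3 * sigma_fps)"
  unfolding numeral_dvd_fps_iff
proof
  fix n
  let ?P = "euler_part 1 (Suc n)" and ?Q = "euler_part 3 (Suc n)"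
  let ?S = "\<Sum>k<Suc n. arith_fps (Suc k)"
  have 1: "fps_X ^ Suc n dvd euler_fps 1 - ?P" and 3: "fps_X ^ Suc n dvd euler_fps 3 - ?Q"
    by (simp_all only: euler_fps_approx zero_less_one zero_less_numeral)
  have "fps_X ^ Suc n dvd euler_fps 1 ^ 3 - ?P ^ 3"
    unfolding power3_eq_cube by (intro dvd_diff_mult 1)
  then have lhs: "fps_nth (euler_fps 1 ^ 3) n = fps_nth (?P ^ 3) n"
    unfolding fps_X_power_dvd_iff by auto
  have ring: "(1 - u) - (1 - v) = - (u - v)" for u v :: "int fps"
    by simp
  have "fps_X ^ Suc n dvd 3 * sigma_fps - 3 * ?S"
    unfolding right_diff_distrib[symmetric] by (intro dvd_mult sigma_fps_approx_arith)
  then have "fps_X ^ Suc n dvd (1 - 3 * sigma_fps) - (1 - 3 * ?S)"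
    by (simp only: ring dvd_minus_iff)
  with 3 have "fps_X ^ Suc n dvd euler_fps 3 * (1 - 3 * sigma_fps) - ?Q * (1 - 3 * ?S)"
    by (rule dvd_diff_mult)
  then have rhs: "fps_nth (euler_fps 3 * (1 - 3 * sigma_fps)) n = fps_nth (?Q * (1 - 3 * ?S)) n"
    unfolding fps_X_power_dvd_iff by auto
  have "9 dvd fps_nth (?P ^ 3 - ?Q * (1 - 3 * ?S)) n"
    using euler_part_cube_mod_9 unfolding numeral_dvd_fps_iff by (rule spec)
  then show "9 dvd fps_nth (euler_fps 1 ^ 3 - euler_fps 3 * (1 - 3 * sigma_fps)) n"
    by (simp only: fps_sub_nth lhs rhs)
qed

section \<open>Series with derivative divisible by 3\<close>

lemma dvd_fps_XD_mult:
  "c dvd fps_XD f \<Longrightarrow> c dvd fps_XD g \<Longrightarrow> c dvd fps_XD (f * g :: 'a :: comm_ring_1 fps)"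
  by (simp add: fps_XD_mult)

lemma three_dvd_fps_XD_cube: "3 dvd fps_XD (f ^ 3 :: int fps)"
proof -
  have "fps_XD (f ^ 3) = 3 * (f\<^sup>2 * fps_XD f)"
    by (simp add: power3_eq_cube power2_eq_square fps_XD_mult algebra_simps)
  then show ?thesis by simp
qed

text \<open>Leibniz applied to g f = 1, then multiplied by g to cancel f. Consequently an inverse
  inherits divisibility of the derivative.\<close>

lemma fps_XD_left_inverse:
  fixes f g :: "'a :: comm_ring_1 fps"
  assumes "g * f = 1"
  shows "fps_XD g = - (g\<^sup>2 * fps_XD f)"
proof -
  have "fps_XD g * f + g * fps_XD f = 0"
    unfolding fps_XD_mult[symmetric] assms by (rule fps_ext) simp
  then have "fps_XD g * f = - (g * fps_XD f)"
    by (simp add: eq_neg_iff_add_eq_0)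
  then have "g * (fps_XD g * f) = g * - (g * fps_XD f)"
    by simp
  moreover have "g * (fps_XD g * f) = fps_XD g * (g * f)"
    by (simp only: mult_ac)
  ultimately show ?thesis
    using assms by (simp add: power2_eq_square mult.assoc)
qed

text \<open>Each factor 1 - X^m has derivative - m X^m with m a multiple of i, hence of 3.\<close>

lemma three_dvd_fps_XD_euler_fps:
  assumes "3 dvd i" "i > 0"
  shows "3 dvd fps_XD (euler_fps i)"
  unfolding numeral_dvd_fps_iff
proof
  fix n
  have "3 dvd fps_XD (euler_part i N)" for N
  proof (induction N)
    case 0
    show ?case by (simp add: fps_XD_def)
  next
    case (Suc N)
    have "3 dvd (of_nat (i * Suc N) :: int fps)"
      using assms(1) by (metis dvd_mult2 of_nat_dvd_iff of_nat_numeral of_nat_mult dvd_def)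
    then show ?case
      unfolding euler_part_Suc using Suc.IH
      by (intro dvd_fps_XD_mult) (auto simp only: fps_XD_one_minus_X_power dvd_minus_iff intro: dvd_mult2)
  qed
  moreover have "fps_nth (fps_XD (euler_fps i)) n = fps_nth (fps_XD (euler_part i (Suc n))) n"
    using euler_fps_approx[OF assms(2), of "Suc n"] unfolding fps_X_power_dvd_iff by simp
  ultimately show "3 dvd fps_nth (fps_XD (euler_fps i)) n"
    unfolding numeral_dvd_fps_iff by metis
qed


subsection \<open>Expansions with integer coefficients on the unit disc\<close>

definition complex_fps :: "int fps \<Rightarrow> complex fps" where
  "complex_fps F = Abs_fps (\<lambda>n. of_int (fps_nth F n))"

lemma complex_fps_nth [simp]: "fps_nth (complex_fps F) n = of_int (fps_nth F n)"
  by (simp add: complex_fps_def)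

lemma complex_fps_1 [simp]: "complex_fps 1 = 1"
  by (rule fps_ext) simp

lemma complex_fps_mult: "complex_fps (F * G) = complex_fps F * complex_fps G"
  by (rule fps_ext) (simp add: fps_mult_nth)

lemma complex_fps_prod: "complex_fps (\<Prod>x\<in>A. F x) = (\<Prod>x\<in>A. complex_fps (F x))"
  by (induction A rule: infinite_finite_induct) (simp_all add: complex_fps_mult)

lemma complex_fps_one_minus_X_power: "complex_fps (1 - fps_X ^ n) = 1 - fps_X ^ n"
  by (rule fps_ext) (simp add: fps_X_power_nth)

text \<open>An expansion at 0 alone concerns only a neighbourhood of 0. Holomorphy on the whole disc
  makes the Taylor series converge to f at every point of it.\<close>

definition disc_expansion :: "(complex \<Rightarrow> complex) \<Rightarrow> int fps \<Rightarrow> bool" where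
  "disc_expansion f F \<longleftrightarrow> f holomorphic_on ball 0 1 \<and> f has_fps_expansion complex_fps F"

lemma disc_expansion_sums:
  assumes "disc_expansion f F" "norm q < 1"
  shows "(\<lambda>n. of_int (fps_nth F n) * q ^ n) sums f q"
proof -
  have holo: "f holomorphic_on ball 0 1" and f: "f has_fps_expansion complex_fps F"
    using assms(1) by (auto simp: disc_expansion_def)
  have "(\<lambda>n. (deriv ^^ n) f 0 / fact n * (q - 0) ^ n) sums f q"
    by (rule holomorphic_power_series[OF holo]) (use assms(2) in simp)
  moreover have "(deriv ^^ n) f 0 / fact n = of_int (fps_nth F n)" for n
    using fps_nth_fps_expansion[OF f, of n] by simp
  ultimately show ?thesis by simp
qed

lemma disc_expansion_1 [simp]: "disc_expansion (\<lambda>_. 1) 1"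
  by (simp add: disc_expansion_def)

lemma disc_expansion_mult:
  "disc_expansion f F \<Longrightarrow> disc_expansion g G \<Longrightarrow> disc_expansion (\<lambda>q. f q * g q) (F * G)"
  by (auto simp: disc_expansion_def complex_fps_mult intro!: holomorphic_intros fps_expansion_intros)

lemma disc_expansion_power:
  "disc_expansion f F \<Longrightarrow> disc_expansion (\<lambda>q. f q ^ n) (F ^ n)"
  by (induction n) (simp_all add: disc_expansion_mult)

lemma disc_expansion_at_0: "disc_expansion f F \<Longrightarrow> f 0 = of_int (fps_nth F 0)"
  using disc_expansion_sums[of f F 0] by (simp add: sums_iff)

text \<open>Constant term 1 makes F invertible over the integers, so the reciprocal again has
  integer coefficients; absence of zeros keeps it holomorphic on the disc.\<close>

lemma disc_expansion_inverse:
  assumes "disc_expansion f F" "fps_nth F 0 = 1" "\<And>q. norm q < 1 \<Longrightarrow> f q \<noteq> 0"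
  obtains G where "G * F = 1" "disc_expansion (\<lambda>q. inverse (f q)) G"
proof -
  define G where "G = fps_left_inverse F 1"
  have GF: "G * F = 1"
    unfolding G_def by (rule fps_left_inverse) (simp add: assms(2))
  have "complex_fps G * complex_fps F = 1"
    by (simp add: GF flip: complex_fps_mult)
  then have "complex_fps G = inverse (complex_fps F)"
    by (metis fps_inverse_unique mult.commute)
  then have "disc_expansion (\<lambda>q. inverse (f q)) G"
    using assms by (auto simp: disc_expansion_def intro!: holomorphic_intros has_fps_expansion_inverse)
  with GF show ?thesis by (rule that)
qed

section \<open>Convergence and holomorphy of Euler products on the unit disc\<close>

lemma norm_powser_factor_le:
  fixes q :: complex
  assumes "i > 0" "norm q \<le> r" "r \<le> 1"
  shows "norm (q ^ (i * Suc k)) \<le> r ^ Suc k"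
proof -
  have "norm (q ^ (i * Suc k)) \<le> r ^ (i * Suc k)"
    unfolding norm_power using assms(2) by (rule power_mono) simp
  \<comment> \<open>Lowering the exponent gives one geometric majorant, whatever i is.\<close>
  also have "\<dots> \<le> r ^ Suc k"
  proof (rule power_decreasing)
    show "Suc k \<le> i * Suc k"
      using assms(1) by (cases i) simp_all
    show "0 \<le> r"
      using norm_ge_zero assms(2) by (rule order_trans)
  qed fact
  finally show ?thesis .
qed

lemma convergent_prod_euler_f:
  fixes q :: complex
  assumes "i > 0" "norm q < 1"
  shows "convergent_prod (\<lambda>k. 1 - q ^ (i * Suc k))"
proof (rule abs_convergent_prod_imp_convergent_prod)
  have "summable (\<lambda>k. norm q ^ Suc k)"
    using assms(2) by (subst summable_Suc_iff) (simp add: summable_geometric)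
  then have "summable (\<lambda>k. norm (q ^ (i * Suc k)))"
    by (rule summable_comparison_test'[where N = 0])
       (use norm_powser_factor_le[OF assms(1), of q "norm q"] assms(2) in simp)
  then show "abs_convergent_prod (\<lambda>k. 1 - q ^ (i * Suc k))"
    by (simp add: abs_convergent_prod_conv_summable)
qed

lemma euler_f_nonzero:
  assumes "i > 0" "norm q < 1"
  shows "euler_f i q \<noteq> 0"
  unfolding euler_f_def
proof (rule prodinf_nonzero)
  show "convergent_prod (\<lambda>n. 1 - q ^ (i * Suc n))"
    using assms by (rule convergent_prod_euler_f)
  fix n
  have "norm (q ^ (i * Suc n)) < 1"
    unfolding norm_power using assms by (intro power_Suc_less_one power_less_one_iff[THEN iffD2]) auto
  then show "1 - q ^ (i * Suc n) \<noteq> 0"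
    by auto
qed

lemma uniform_limit_euler_f:
  assumes "i > 0" "r < 1"
  shows "uniform_limit (cball 0 r) (\<lambda>N q. \<Prod>k<N. 1 - q ^ (i * Suc k)) (euler_f i) sequentially"
proof -
  have "uniformly_convergent_on (cball 0 r) (\<lambda>N q :: complex. \<Prod>k<N. 1 - q ^ (i * Suc k))"
  \<comment> \<open>For negative r the disc is empty; otherwise the Weierstrass test applies with
    the majorant r^(k+1).\<close>
  proof (cases "r \<ge> 0")
    case True
    show ?thesis
    proof (rule uniformly_convergent_on_prod')
      show "uniformly_convergent_on (cball 0 r)
          (\<lambda>N q :: complex. \<Sum>k<N. norm (1 - q ^ (i * Suc k) - 1))"
      proof (rule Weierstrass_m_test')
        show "summable (\<lambda>k. r ^ Suc k)"
          using assms(2) True by (subst summable_Suc_iff) (simp add: summable_geometric)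
        show "norm (norm (1 - q ^ (i * Suc k) - 1)) \<le> r ^ Suc k" if "q \<in> cball 0 r" for k and q :: complex
          using norm_powser_factor_le[OF assms(1), of q r k] assms(2) that by simp
      qed
    qed (auto intro!: continuous_intros)
  qed (simp add: uniformly_convergent_on_def)
  then obtain g where
    g: "uniform_limit (cball 0 r) (\<lambda>N q :: complex. \<Prod>k<N. 1 - q ^ (i * Suc k)) g sequentially"
    by (auto simp: uniformly_convergent_on_def)
  \<comment> \<open>The uniform limit g is identified pointwise with the value of the convergent
    infinite product.\<close>
  also have "?this \<longleftrightarrow> ?thesis"
  proof (intro uniform_limit_cong)
    fix q :: complex assume q: "q \<in> cball 0 r"
    have "(\<lambda>N. \<Prod>k<N. 1 - q ^ (i * Suc k)) \<longlonglongrightarrow> g q"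
      using g q by (rule tendsto_uniform_limitI)
    moreover have "convergent_prod (\<lambda>k. 1 - q ^ (i * Suc k))"
      using assms q by (intro convergent_prod_euler_f) auto
    then have "(\<lambda>N. \<Prod>k<N. 1 - q ^ (i * Suc k)) \<longlonglongrightarrow> euler_f i q"
      unfolding euler_f_def by (intro has_prod_imp_tendsto' convergent_prod_has_prod)
    ultimately show "g q = euler_f i q"
      using LIMSEQ_unique by blast
  qed auto
  finally show ?thesis .
qed

text \<open>The partial products are polynomials converging locally uniformly, so the limit is
  holomorphic and its Taylor coefficients are the limits of theirs, which are eventually
  constant.\<close>

theorem disc_expansion_euler_f:
  assumes "i > 0"
  shows "disc_expansion (euler_f i) (euler_fps i)"
proof -
  have holo: "euler_f i holomorphic_on ball 0 1"
  proof (rule holomorphic_uniform_sequence)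
    fix z :: complex assume "z \<in> ball 0 1"
    then obtain r where r: "norm z < r" "r < 1"
      using dense by auto
    \<comment> \<open>With r strictly between the norm of z and 1, this disc around z has positive
      radius and stays where convergence is uniform.\<close>
    have "cball z (r - norm z) \<subseteq> cball 0 r"
      by (simp add: cball_subset_cball_iff)
    with uniform_limit_euler_f[OF assms r(2)]
    have "uniform_limit (cball z (r - norm z)) (\<lambda>N q. \<Prod>k<N. 1 - q ^ (i * Suc k)) (euler_f i) sequentially"
      by (rule uniform_limit_on_subset)
    moreover have "cball z (r - norm z) \<subseteq> ball 0 1"
      using r by (simp add: cball_subset_ball_iff)
    ultimately show "\<exists>d>0. cball z d \<subseteq> ball 0 1
        \<and> uniform_limit (cball z d) (\<lambda>N q. \<Prod>k<N. 1 - q ^ (i * Suc k)) (euler_f i) sequentially"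
      using r(1) by (intro exI[of _ "r - norm z"]) simp
  qed (auto intro!: holomorphic_intros)
  then have expansion: "euler_f i has_fps_expansion fps_expansion (euler_f i) 0"
    by (intro has_fps_expansion_fps_expansion) auto
  have "fps_expansion (euler_f i) 0 = complex_fps (euler_fps i)"
  proof (rule uniform_limit_imp_fps_expansion_eq)
    show "(\<lambda>N. complex_fps (euler_part i N)) \<longlonglongrightarrow> complex_fps (euler_fps i)"
      unfolding tendsto_fps_iff
    proof
      fix n
      have "fps_nth (euler_part i N) n = fps_nth (euler_fps i) n" if "N > n" for N
        using euler_fps_approx[OF assms, of N] that unfolding fps_X_power_dvd_iff by simp
      then show "\<forall>\<^sub>F N in sequentially.
          fps_nth (complex_fps (euler_part i N)) n = fps_nth (complex_fps (euler_fps i)) n"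
        by (intro eventually_mono[OF eventually_gt_at_top[of n]]) simp
    qed
    show "uniform_limit (ball 0 (1/2)) (\<lambda>N q. \<Prod>k<N. 1 - q ^ (i * Suc k)) (euler_f i) sequentially"
      by (rule uniform_limit_on_subset[OF uniform_limit_euler_f[OF assms, of "1/2"]]) auto
    have "(\<lambda>q. \<Prod>k<N. 1 - q ^ (i * Suc k)) has_fps_expansion complex_fps (euler_part i N)" for N
      unfolding euler_part_def complex_fps_prod complex_fps_one_minus_X_power
      by (intro fps_expansion_intros)
    then show "\<forall>\<^sub>F N in sequentially.
        (\<lambda>q. \<Prod>k<N. 1 - q ^ (i * Suc k)) has_fps_expansion complex_fps (euler_part i N)"
      by simp
    show "\<forall>\<^sub>F N in sequentially. (\<lambda>q. \<Prod>k<N. 1 - q ^ (i * Suc k)) holomorphic_on ball 0 (1/2)"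
      by (intro always_eventually allI holomorphic_intros)
  qed (use expansion in auto)
  with holo expansion show ?thesis
    by (simp add: disc_expansion_def)
qed

section \<open>Closure properties of functions flat modulo 3\<close>

text \<open>
  A power series has derivative divisible by 3 iff it is congruent modulo 3 to a power series
  in \<open>q ^ 3\<close>.
\<close>

definition flat_mod_3 :: "(complex \<Rightarrow> complex) \<Rightarrow> bool" where
  "flat_mod_3 f \<longleftrightarrow> (\<exists>F. disc_expansion f F \<and> 3 dvd fps_XD F)"

lemma flat_mod_3_mult: "flat_mod_3 f \<Longrightarrow> flat_mod_3 g \<Longrightarrow> flat_mod_3 (\<lambda>q. f q * g q)"
  unfolding flat_mod_3_def using disc_expansion_mult dvd_fps_XD_mult by metis

lemma flat_mod_3_1: "flat_mod_3 (\<lambda>_. 1)"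
  unfolding flat_mod_3_def by (intro exI[of _ 1]) (simp add: fps_XD_def)

lemma flat_mod_3_prod:
  "(\<And>x. x \<in> A \<Longrightarrow> flat_mod_3 (f x)) \<Longrightarrow> flat_mod_3 (\<lambda>q. \<Prod>x\<in>A. f x q)"
  by (induction A rule: infinite_finite_induct) (simp_all add: flat_mod_3_1 flat_mod_3_mult)

lemma flat_mod_3_power: "flat_mod_3 f \<Longrightarrow> flat_mod_3 (\<lambda>q. f q ^ n)"
  by (induction n) (simp_all add: flat_mod_3_1 flat_mod_3_mult)

lemma flat_mod_3_cube: "disc_expansion f F \<Longrightarrow> flat_mod_3 (\<lambda>q. f q ^ 3)"
  unfolding flat_mod_3_def using disc_expansion_power three_dvd_fps_XD_cube by metis

text \<open>A negative power is a power of the reciprocal, which exists over the integers by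
  \<open>f 0 = 1\<close> and has derivative - D f / f^2, again divisible by 3.\<close>

lemma flat_mod_3_power_int:
  assumes "flat_mod_3 f" "f 0 = 1" "\<And>q. norm q < 1 \<Longrightarrow> f q \<noteq> 0"
  shows "flat_mod_3 (\<lambda>q. f q powi e)"
proof -
  obtain F where F: "disc_expansion f F" "3 dvd fps_XD F"
    using assms(1) by (auto simp: flat_mod_3_def)
  have "fps_nth F 0 = 1"
    using disc_expansion_at_0[OF F(1)] assms(2) by simp
  then obtain G where G: "G * F = 1" "disc_expansion (\<lambda>q. inverse (f q)) G"
    using disc_expansion_inverse[OF F(1)] assms(3) by metis
  have "flat_mod_3 (\<lambda>q. inverse (f q))"
    unfolding flat_mod_3_def using G(2) F(2) by (auto simp: fps_XD_left_inverse[OF G(1)])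
  with assms(1) show ?thesis
    by (cases "e \<ge> 0") (simp_all add: power_int_def flat_mod_3_power)
qed

lemma euler_f_at_0: "i > 0 \<Longrightarrow> euler_f i 0 = 1"
  using disc_expansion_at_0[OF disc_expansion_euler_f] by simp

text \<open>The cube is taken first: it is flat for every index i, and flatness passes to its
  integer powers.\<close>

lemma flat_mod_3_euler_f_cube_powi:
  assumes "i > 0"
  shows "flat_mod_3 (\<lambda>q. euler_f i q powi (3 * e))"
proof -
  have "flat_mod_3 (\<lambda>q. (euler_f i q ^ 3) powi e)"
    using assms
    by (intro flat_mod_3_power_int flat_mod_3_cube[OF disc_expansion_euler_f])
       (simp_all add: euler_f_at_0 euler_f_nonzero)
  then show ?thesis by (simp add: power_int_mult)
qed

lemma flat_mod_3_euler_f_powi: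
  assumes "i > 0" "3 dvd i"
  shows "flat_mod_3 (\<lambda>q. euler_f i q powi e)"
proof (rule flat_mod_3_power_int)
  show "flat_mod_3 (euler_f i)"
    unfolding flat_mod_3_def
    using disc_expansion_euler_f three_dvd_fps_XD_euler_fps assms by blast
qed (use assms in \<open>simp_all add: euler_f_at_0 euler_f_nonzero\<close>)

section \<open>The congruences between the coefficients of A and B\<close>

theorem theorem3p3:
  fixes j :: "nat \<Rightarrow> int" and T U :: "nat set"
  assumes "finite T" and "T \<subseteq> {i. 1 < i \<and> \<not> 3 dvd i}"
    and "finite U" and "U \<subseteq> {i. 0 < i \<and> 3 dvd i}"
  shows "\<exists>a b :: nat \<Rightarrow> int.
      (\<forall>q::complex. norm q < 1 \<longrightarrow> (\<lambda>n. of_int (a n) * q ^ n) sums eta_A j T U q) \<and>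
      (\<forall>q::complex. norm q < 1 \<longrightarrow> (\<lambda>n. of_int (b n) * q ^ n) sums eta_B j T U q) \<and>
      (\<forall>n. [a (3 * n) - b (3 * n) = 0] (mod 9) \<and>
           [2 * a (3 * n + 1) + b (3 * n + 1) = 0] (mod 9) \<and>
           [a (3 * n + 2) + 2 * b (3 * n + 2) = 0] (mod 9))"
proof -
  let ?E = "euler_fps 1" and ?E3 = "euler_fps 3"
  \<comment> \<open>This is A with a single factor f_1 removed. What remains consists of powers of
    cubes and of f_i with 3 dividing i.\<close>
  define g where "g q = euler_f 1 q powi (3 * j 1) *
      (\<Prod>i\<in>T. euler_f i q powi (3 * j i)) * (\<Prod>i\<in>U. euler_f i q powi (j i))" for q
  have "flat_mod_3 g"
    unfolding g_def using assms(2,4)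
    by (intro flat_mod_3_mult flat_mod_3_prod flat_mod_3_euler_f_cube_powi flat_mod_3_euler_f_powi)
       auto
  then obtain K where K: "disc_expansion g K" "3 dvd fps_XD K"
    by (auto simp: flat_mod_3_def)
  have E: "disc_expansion (euler_f 1) ?E" and E3: "disc_expansion (euler_f 3) ?E3"
    by (simp_all add: disc_expansion_euler_f)
  obtain D where D: "D * ?E = 1" "disc_expansion (\<lambda>q. inverse (euler_f 1 q)) D"
    using disc_expansion_inverse[OF E] euler_f_nonzero[of 1] by auto
  obtain D3 where D3: "D3 * ?E3 = 1"
    using disc_expansion_inverse[OF E3] euler_f_nonzero[of 3] by auto

  define a b where "a = ?E * K" and "b = (?E3 * D ^ 3) * a"
  have "disc_expansion (\<lambda>q. euler_f 1 q * g q) a"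
    unfolding a_def using E K(1) by (rule disc_expansion_mult)
  \<comment> \<open>Splitting the exponent 3 j_1 + 1 of f_1, possibly negative, uses that f_1 has no
    zero on the disc.\<close>
  then have A: "(\<lambda>n. of_int (fps_nth a n) * q ^ n) sums eta_A j T U q" if "norm q < 1" for q
    using disc_expansion_sums[OF _ that] euler_f_nonzero[of 1 q] that
    by (force simp: eta_A_def g_def power_int_add mult_ac)
  have "disc_expansion (\<lambda>q. (euler_f 3 q * inverse (euler_f 1 q) ^ 3) * (euler_f 1 q * g q)) b"
    unfolding a_def b_def by (intro disc_expansion_mult disc_expansion_power E E3 D(2) K(1))
  then have B: "(\<lambda>n. of_int (fps_nth b n) * q ^ n) sums eta_B j T U q" if "norm q < 1" for q
    using disc_expansion_sums[OF _ that] euler_f_nonzero[of 1 q] that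
    by (force simp: eta_B_def eta_A_def g_def power_int_add mult_ac divide_inverse power_inverse)

  have "9 dvd a - (1 - 3 * sigma_fps) * b"
  proof -
    \<comment> \<open>Multiplying by D3 b turns E^3 into a, because b = E3 D^3 a and both inverses
      cancel, and turns E3 (1 - 3 L) into (1 - 3 L) b.\<close>
    have "9 dvd D3 * b * (?E ^ 3 - ?E3 * (1 - 3 * sigma_fps))"
      by (intro dvd_mult euler_fps_cube_mod_9)
    also have "D3 * b * (?E ^ 3 - ?E3 * (1 - 3 * sigma_fps))
        = (D3 * ?E3) * (D * ?E) ^ 3 * a - (D3 * ?E3) * (1 - 3 * sigma_fps) * b"
      by (simp add: b_def right_diff_distrib power_mult_distrib mult_ac)
    finally show ?thesis by (simp only: D D3 power_one mult_1)
  qed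
  moreover have "9 dvd 3 * fps_XD b + 3 * sigma_fps * b"
  proof -
    \<comment> \<open>B is f_1 times this series, which is still flat modulo 3; only f_1 contributes
      to D b modulo 3, and the extra factor 3 lifts the congruence to modulo 9.\<close>
    define K' where "K' = ?E3 * D ^ 3 * K"
    have b: "b = ?E * K'" by (simp add: b_def a_def K'_def mult_ac)
    have "3 dvd fps_XD K'"
      unfolding K'_def
      by (intro dvd_fps_XD_mult three_dvd_fps_XD_euler_fps three_dvd_fps_XD_cube K(2)) auto
    then have "3 * 3 dvd 3 * (?E * fps_XD K')"
      by (intro mult_dvd_mono) auto
    also have "3 * (?E * fps_XD K') = 3 * fps_XD b + 3 * sigma_fps * b"
      unfolding b fps_XD_mult fps_XD_euler_fps_1 by (simp add: algebra_simps)
    finally show ?thesis by simp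
  qed
  \<comment> \<open>The terms with the divisor sum cancel, leaving a = b + 3 D b modulo 9.\<close>
  ultimately have "9 dvd (a - (1 - 3 * sigma_fps) * b) - (3 * fps_XD b + 3 * sigma_fps * b)"
    by (rule dvd_diff)
  also have "\<dots> = a - b - 3 * fps_XD b"
    by (simp add: algebra_simps)
  finally have key: "9 dvd fps_nth a n - fps_nth b n - 3 * (int n * fps_nth b n)" for n
    unfolding numeral_dvd_fps_iff by (simp add: fps_numeral_fps_const)
  \<comment> \<open>For indices congruent to 0, 1, 2 modulo 3 the multiplier 1 + 3 n is 1, 4, 7
    modulo 9. Hence a = b, 2 a + b = 9 b = 0 and a + 2 b = 9 b = 0 modulo 9.\<close>
  have "[fps_nth a (3 * n) - fps_nth b (3 * n) = 0] (mod 9)" for n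
  proof -
    have "x - y = (x - y - 3 * (int (3 * n) * y)) + 9 * (int n * y)" for x y
      by (simp add: algebra_simps)
    then show ?thesis
      unfolding cong_0_iff by (metis dvd_add dvd_triv_left key)
  qed
  moreover have "[2 * fps_nth a (3 * n + 1) + fps_nth b (3 * n + 1) = 0] (mod 9)" for n
  proof -
    have "2 * x + y = 2 * (x - y - 3 * (int (3 * n + 1) * y)) + 9 * (y + 2 * int n * y)" for x y
      by (simp add: algebra_simps)
    then show ?thesis
      unfolding cong_0_iff by (metis dvd_add dvd_mult dvd_triv_left key)
  qed
  moreover have "[fps_nth a (3 * n + 2) + 2 * fps_nth b (3 * n + 2) = 0] (mod 9)" for n
  proof -
    have "x + 2 * y = (x - y - 3 * (int (3 * n + 2) * y)) + 9 * (y + int n * y)" for x y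
      by (simp add: algebra_simps)
    then show ?thesis
      unfolding cong_0_iff by (metis dvd_add dvd_triv_left key)
  qed
  ultimately show ?thesis
    using A B by (intro exI[of _ "fps_nth a"] exI[of _ "fps_nth b"]) blast
qed

end
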